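(* Let $A,B\in\mathbb{C}^{n\times n}$ with $A^{\mathsf H}=A$, $B^{\mathsf T}=B$, and $H=\begin{bmatrix}A&B\\ -\overline{B}&-\overline{A}\end{bmatrix}$. Let $\alpha>0$ be such that $\alpha I_{2n}-H$, $\alpha I_n-A$, $R\equiv I_n-(\alpha I_n-\overline{A})^{-1}\overline{B}(\alpha I_n-A)^{-1}B$ and $E_\alpha$ are nonsingular, and let $\{E_k\}$, $\{F_k\}$ be the sequences generated by the doubling iteration (defined in the context), with $1\notin\sigma(F_k)$ for all $k\ge0$. Assume that $H$ possesses no purely imaginary eigenvalue and that $$H\begin{bmatrix}X_1\\ X_2\end{bmatrix}=\begin{bmatrix}X_1\\ X_2\end{bmatrix}S$$ with $X_1,X_2,S\in\mathbb{C}^{n\times n}$, where $X_1$ is nonsingular and the spectrum of $S$ is in the interior of the left half plane. Then $$\lim_{k\to\infty}E_k=0,\qquad \lim_{k\to\infty}F_k=-X_2X_1^{-1},$$ both converging quadratically.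
   Context: $\overline{(\cdot)}$ denotes entrywise complex conjugate and $\sigma(\cdot)$ the set of singular values. The initial matrices are $$E_0=E_\alpha\equiv I_n+2\alpha\,\overline{R}^{-1}(A-\alpha I_n)^{-1},\qquad F_0=F_\alpha\equiv-2\alpha(\overline{A}-\alpha I_n)^{-1}\overline{B}\,\overline{R}^{-1}(A-\alpha I_n)^{-1}.$$ The doubling iteration is, for $k=0,1,\dots$, $$E_{k+1}=E_k(I_n-\overline{F}_kF_k)^{-1}E_k,\qquad F_{k+1}=F_k+\overline{E}_kF_k(I_n-\overline{F}_kF_k)^{-1}E_k,$$ which is well defined when $1\notin\sigma(F_k)$ for all $k$ (equivalently, $I_n-\overline{F}_kF_k$ is nonsingular for all $k$). "Converging quadratically" is meant in the sense usual for doubling algorithms: the norm of the error at step $k$ is at most $C\rho^{2^k}$ for some constants $C>0$, $0<\rho<1$. *)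

theory Defs
  imports "HOL-Analysis.Analysis"
begin

abbreviation cnj_matrix :: "complex^'n^'m \<Rightarrow> complex^'n^'m" where
  "cnj_matrix \<equiv> map_matrix cnj"

definition conj_transpose :: "complex^'n^'m \<Rightarrow> complex^'m^'n" where
  "conj_transpose M = transpose (cnj_matrix M)"

definition eigenvalues :: "complex^'n^'n \<Rightarrow> complex set" where
  "eigenvalues M = {\<mu>. \<exists>v. v \<noteq> 0 \<and> M *v v = \<mu> *s v}"

definition singular_values :: "complex^'n^'m \<Rightarrow> real set" where
  "singular_values M = {s. 0 \<le> s \<and> complex_of_real (s\<^sup>2) \<in> eigenvalues (conj_transpose M ** M)}"

(* The index type 'n + 'n plays the role of {1..2n}: Inl indexes the first block, Inr the second. *)
definition block_matrix ::
    "'a^'n^'n \<Rightarrow> 'a^'n^'n \<Rightarrow> 'a^'n^'n \<Rightarrow> 'a^'n^'n \<Rightarrow> 'a^('n + 'n)^('n + 'n)" where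
  "block_matrix P Q U V =
     (\<chi> i j. case i of
        Inl k \<Rightarrow> (case j of Inl l \<Rightarrow> P $ k $ l | Inr l \<Rightarrow> Q $ k $ l)
      | Inr k \<Rightarrow> (case j of Inl l \<Rightarrow> U $ k $ l | Inr l \<Rightarrow> V $ k $ l))"

definition stack_matrix :: "'a^'n^'n \<Rightarrow> 'a^'n^'n \<Rightarrow> 'a^'n^('n + 'n)" where
  "stack_matrix P Q = (\<chi> i. case i of Inl k \<Rightarrow> P $ k | Inr k \<Rightarrow> Q $ k)"

definition H_matrix :: "complex^'n^'n \<Rightarrow> complex^'n^'n \<Rightarrow> complex^('n + 'n)^('n + 'n)" where
  "H_matrix A B = block_matrix A B (- cnj_matrix B) (- cnj_matrix A)"

(* mat c is the scalar matrix c I. *)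
definition R_matrix :: "real \<Rightarrow> complex^'n^'n \<Rightarrow> complex^'n^'n \<Rightarrow> complex^'n^'n" where
  "R_matrix \<alpha> A B =
     mat 1 - matrix_inv (mat (of_real \<alpha>) - cnj_matrix A) ** cnj_matrix B
             ** matrix_inv (mat (of_real \<alpha>) - A) ** B"

definition E_init :: "real \<Rightarrow> complex^'n^'n \<Rightarrow> complex^'n^'n \<Rightarrow> complex^'n^'n" where
  "E_init \<alpha> A B =
     mat 1 + (2 * \<alpha>) *\<^sub>R (matrix_inv (cnj_matrix (R_matrix \<alpha> A B)) ** matrix_inv (A - mat (of_real \<alpha>)))"

definition F_init :: "real \<Rightarrow> complex^'n^'n \<Rightarrow> complex^'n^'n \<Rightarrow> complex^'n^'n" where
  "F_init \<alpha> A B =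
     (- 2 * \<alpha>) *\<^sub>R (matrix_inv (cnj_matrix A - mat (of_real \<alpha>)) ** cnj_matrix B
       ** matrix_inv (cnj_matrix (R_matrix \<alpha> A B)) ** matrix_inv (A - mat (of_real \<alpha>)))"

fun doubling_E doubling_F :: "real \<Rightarrow> complex^'n^'n \<Rightarrow> complex^'n^'n \<Rightarrow> nat \<Rightarrow> complex^'n^'n" where
  "doubling_E \<alpha> A B 0 = E_init \<alpha> A B"
| "doubling_E \<alpha> A B (Suc k) =
     doubling_E \<alpha> A B k
     ** matrix_inv (mat 1 - cnj_matrix (doubling_F \<alpha> A B k) ** doubling_F \<alpha> A B k)
     ** doubling_E \<alpha> A B k"
| "doubling_F \<alpha> A B 0 = F_init \<alpha> A B"
| "doubling_F \<alpha> A B (Suc k) =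
     doubling_F \<alpha> A B k
     + cnj_matrix (doubling_E \<alpha> A B k) ** doubling_F \<alpha> A B k
       ** matrix_inv (mat 1 - cnj_matrix (doubling_F \<alpha> A B k) ** doubling_F \<alpha> A B k)
       ** doubling_E \<alpha> A B k"

(* Quadratic convergence as for doubling algorithms: an R-type error bound that asks nothing about
   ratios of consecutive errors. *)
definition quadratic_rate :: "(nat \<Rightarrow> 'a::real_normed_vector) \<Rightarrow> 'a \<Rightarrow> bool" where
  "quadratic_rate X L \<longleftrightarrow>
     (\<exists>C \<rho>. C > 0 \<and> 0 < \<rho> \<and> \<rho> < 1 \<and> (\<forall>k. norm (X k - L) \<le> C * \<rho> ^ (2 ^ k)))"

end

theory Submission
  imports Defs "HOL-Computational_Algebra.Fundamental_Theorem_Algebra"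
begin

text \<open>
  Put \<open>X = X2 X1\<^sup>-\<^sup>1\<close>, \<open>G = X1 S X1\<^sup>-\<^sup>1\<close>, and let \<open>T = (G + \<alpha>)(G - \<alpha>)\<^sup>-\<^sup>1\<close> be the Cayley transform
  of \<open>G\<close>. The invariant subspace relation for \<open>H\<close> says that the graph of \<open>X\<close> is invariant, with
  \<open>G\<close> as the restriction of \<open>H\<close>. Writing a bar for the entrywise conjugate \<open>cnj_matrix\<close>, the pair
  \<open>(E\<^sub>0, F\<^sub>0)\<close> encodes the Cayley transform of \<open>H\<close>, and on that graph this means
    \<open>E\<^sub>k = (1 + bar F\<^sub>k X) T\<^sub>k\<close> and \<open>F\<^sub>k + X = bar E\<^sub>k X T\<^sub>k\<close>
  with \<open>k = 0\<close> and \<open>T\<^sub>0 = T\<close> (lemma \<open>initial_pair\<close>). A doubling step preserves both relations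
  while it squares \<open>T\<^sub>k\<close> (lemma \<open>doubling_step_graph\<close>), so they hold for all \<open>k\<close> with
  \<open>T\<^sub>k = T^(2^k)\<close>.

  The two relations already force convergence. Substituting the conjugate of the second into the
  first eliminates \<open>F\<^sub>k\<close> and leaves
    \<open>E\<^sub>k (1 - bar X bar T\<^sub>k X T\<^sub>k) = (1 - bar X X) T\<^sub>k\<close>,
  so \<open>E\<^sub>k\<close> is of the order of \<open>T\<^sub>k\<close> as soon as \<open>T\<^sub>k\<close> is small, and then so is \<open>F\<^sub>k + X\<close>
  (lemma \<open>graph_relations_quadratic_rate\<close>). The spectrum of \<open>S\<close> lies in the left half plane, which
  the Cayley transform maps into the open unit disc; the powers of \<open>T\<close> therefore decay
  geometrically (lemma \<open>mat_power_geometric_decay\<close>), and along the exponents \<open>2^k\<close> this is the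
  quadratic rate.

  That \<open>A\<close> is Hermitian and \<open>B\<close> symmetric makes every \<open>F\<^sub>k\<close> symmetric (lemmas \<open>initial_pair\<close>
  and \<open>doubling_step_symmetric\<close>), so that \<open>F\<^sub>k\<^sup>H F\<^sub>k = bar F\<^sub>k F\<^sub>k\<close>, and \<open>1\<close> not being a singular value of \<open>F\<^sub>k\<close> says
  exactly that \<open>1 - bar F\<^sub>k F\<^sub>k\<close> is invertible.
\<close>

section \<open>Algebra of complex matrices\<close>

lemma bounded_bilinear_matrix_mult:
  "bounded_bilinear ((**) :: complex^'n^'m \<Rightarrow> complex^'p^'n \<Rightarrow> complex^'p^'m)"
proof -
  have "bilinear ((**) :: complex^'n^'m \<Rightarrow> complex^'p^'n \<Rightarrow> complex^'p^'m)"
    unfolding bilinear_def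
    by (auto intro!: linearI
        simp: matrix_matrix_mult_def vec_eq_iff sum.distrib algebra_simps scaleR_sum_right)
  then show ?thesis
    by (simp add: bilinear_conv_bounded_bilinear)
qed

interpretation matrix_mult:
  bounded_bilinear "(**) :: complex^'n^'m \<Rightarrow> complex^'p^'n \<Rightarrow> complex^'p^'m"
  by (rule bounded_bilinear_matrix_mult)

lemmas matrix_ring_simps =
  matrix_mult.add_left matrix_mult.add_right matrix_mult.diff_left matrix_mult.diff_right
  matrix_mult.minus_left matrix_mult.minus_right matrix_mult.scaleR_left matrix_mult.scaleR_right
  matrix_mul_assoc

lemma mat_mult_component: "(mat a ** M) $ i $ j = (a :: complex) * M $ i $ j"
  by (simp add: matrix_matrix_mult_def mat_def if_distrib if_distribR cong: if_cong)

lemma mat_mult_commute: "mat a ** M = M ** mat (a :: complex)"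
  for M :: "complex^'n^'n"
  by (simp add: vec_eq_iff mat_mult_component)
     (simp add: matrix_matrix_mult_def mat_def if_distrib if_distribR cong: if_cong)

lemma mat_mult_mat: "mat a ** mat b = (mat (a * b) :: complex^'n^'n)"
  by (simp add: vec_eq_iff mat_mult_component) (simp add: mat_def)

lemma mat_add: "mat (a + b) = (mat a + mat b :: complex^'n^'n)"
  by (simp add: vec_eq_iff mat_def)

lemma mat_of_real: "mat (complex_of_real a) = a *\<^sub>R (mat 1 :: complex^'n^'n)"
  by (simp add: vec_eq_iff mat_def of_real_def)

lemma mat_mult_vec: "mat a *v v = a *s (v :: complex^'n)"
  by (simp add: vec_eq_iff matrix_vector_mult_def mat_def if_distrib if_distribR cong: if_cong)

lemma norm_mat_mult: "norm (mat a ** M) = cmod a * norm M"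
proof -
  have "norm ((mat a ** M) $ i) = cmod a * norm (M $ i)" for i
    by (simp add: norm_vec_def mat_mult_component norm_mult L2_set_right_distrib)
  then show ?thesis
    by (simp add: norm_vec_def[of "mat a ** M"] norm_vec_def[of M] L2_set_right_distrib)
qed

lemma cnj_matrix_mult: "cnj_matrix (M ** N) = cnj_matrix M ** cnj_matrix N"
  by (simp add: vec_eq_iff matrix_matrix_mult_def)

lemma cnj_matrix_add: "cnj_matrix (M + N) = cnj_matrix M + cnj_matrix N"
  and cnj_matrix_diff: "cnj_matrix (M - N) = cnj_matrix M - cnj_matrix N"
  and cnj_matrix_minus: "cnj_matrix (- M) = - cnj_matrix M"
  and cnj_matrix_scaleR: "cnj_matrix (r *\<^sub>R M) = r *\<^sub>R cnj_matrix M"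
  and cnj_matrix_cnj: "cnj_matrix (cnj_matrix M) = M"
  by (simp_all add: vec_eq_iff)

lemma cnj_matrix_mat: "cnj_matrix (mat a) = mat (cnj a)"
  by (simp add: vec_eq_iff mat_def)

lemmas cnj_matrix_simps =
  cnj_matrix_mult cnj_matrix_add cnj_matrix_diff cnj_matrix_minus cnj_matrix_scaleR
  cnj_matrix_cnj cnj_matrix_mat

lemma transpose_cnj_matrix: "transpose (cnj_matrix M) = cnj_matrix (transpose M)"
  by (simp add: vec_eq_iff transpose_def)

lemma norm_cnj_matrix: "norm (cnj_matrix M) = norm M"
  by (simp add: norm_vec_def)

lemma transpose_add: "transpose (M + N) = transpose M + transpose (N :: complex^'n^'m)"
  and transpose_diff: "transpose (M - N) = transpose M - transpose (N :: complex^'n^'m)"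
  by (simp_all add: vec_eq_iff transpose_def)

lemma matrix_inv_right: "invertible M \<Longrightarrow> M ** matrix_inv M = mat 1"
  and matrix_inv_left: "invertible M \<Longrightarrow> matrix_inv M ** M = mat 1"
  unfolding invertible_def matrix_inv_def by (metis (mono_tags, lifting) someI_ex)+

lemma matrix_inv_unique:
  fixes M N :: "complex^'n^'n"
  assumes "M ** N = mat 1"
  shows "matrix_inv M = N"
proof -
  have "invertible M" using assms invertible_right_inverse by blast
  then have "matrix_inv M ** (M ** N) = N"
    by (simp add: matrix_mul_assoc matrix_inv_left)
  then show ?thesis by (simp add: assms)
qed

lemma matrix_mult_left_cancel:
  fixes M N P :: "complex^'n^'n"
  assumes "invertible M" "M ** N = M ** P"
  shows "N = P"
  by (metis assms matrix_inv_left matrix_mul_assoc matrix_mul_lid)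

lemma matrix_mult_right_cancel:
  fixes M N P :: "complex^'n^'n"
  assumes "invertible M" "N ** M = P ** M"
  shows "N = P"
  by (metis assms matrix_inv_right matrix_mul_assoc matrix_mul_rid)

lemma invertible_cnj_matrix:
  fixes M :: "complex^'n^'n"
  assumes "invertible M"
  shows "invertible (cnj_matrix M)"
proof -
  have "cnj_matrix M ** cnj_matrix (matrix_inv M) = mat 1"
    using assms by (simp add: matrix_inv_right cnj_matrix_mat flip: cnj_matrix_mult)
  then show ?thesis using invertible_right_inverse by blast
qed

lemma cnj_matrix_inv:
  fixes M :: "complex^'n^'n"
  assumes "invertible M"
  shows "cnj_matrix (matrix_inv M) = matrix_inv (cnj_matrix M)"
  by (rule matrix_inv_unique[symmetric])
     (use assms in \<open>simp add: matrix_inv_right cnj_matrix_mat flip: cnj_matrix_mult\<close>)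

lemma transpose_matrix_inv:
  fixes M :: "complex^'n^'n"
  assumes "invertible M"
  shows "transpose (matrix_inv M) = matrix_inv (transpose M)"
  by (rule matrix_inv_unique[symmetric])
     (use assms in \<open>simp add: matrix_inv_left flip: matrix_transpose_mul\<close>)

lemma eigenvalue_iff_not_invertible:
  fixes M :: "complex^'n^'n"
  shows "\<mu> \<in> eigenvalues M \<longleftrightarrow> \<not> invertible (M - mat \<mu>)"
proof -
  have "(M - mat \<mu>) *v v = 0 \<longleftrightarrow> M *v v = \<mu> *s v" for v
    by (simp add: matrix_vector_mult_diff_rdistrib mat_mult_vec)
  then show ?thesis
    by (auto simp: invertible_left_inverse matrix_left_invertible_ker eigenvalues_def)
qed

section \<open>Powers of a matrix with spectrum inside the unit disc\<close>

primrec mat_power :: "complex^'n^'n \<Rightarrow> nat \<Rightarrow> complex^'n^'n" where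
  "mat_power T 0 = mat 1"
| "mat_power T (Suc k) = T ** mat_power T k"

lemma mat_power_add: "mat_power T (i + j) = mat_power T i ** mat_power T j"
  by (induction i) (simp_all add: matrix_mul_assoc)

lemma mat_power_commute: "M ** T = T ** M \<Longrightarrow> M ** mat_power T k = mat_power T k ** M"
  by (induction k) (simp_all add: matrix_mul_assoc, simp flip: matrix_mul_assoc)

text \<open>
  The Horner scheme, which reduces the algebraic laws to inductions along \<^const>\<open>pCons\<close>.
\<close>

definition matrix_poly :: "complex poly \<Rightarrow> complex^'n^'n \<Rightarrow> complex^'n^'n" where
  "matrix_poly p T = fold_coeffs (\<lambda>a M. mat a + T ** M) p 0"

lemma matrix_poly_0: "matrix_poly 0 T = 0"
  by (simp add: matrix_poly_def)

lemma matrix_poly_pCons: "matrix_poly (pCons a p) T = mat a + T ** matrix_poly p T"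
  by (cases "p = 0 \<and> a = 0") (auto simp: matrix_poly_def)

lemma matrix_poly_add: "matrix_poly (p + q) T = matrix_poly p T + matrix_poly q T"
  by (induction p q rule: poly_induct2)
     (simp_all add: matrix_poly_0 matrix_poly_pCons matrix_ring_simps mat_add)

lemma matrix_poly_smult: "matrix_poly (smult c p) T = mat c ** matrix_poly p T"
  by (induction p)
     (simp_all add: matrix_poly_0 matrix_poly_pCons matrix_ring_simps mat_mult_mat
       mat_mult_commute[of c T])

lemma matrix_poly_commute: "T ** matrix_poly p T = matrix_poly p T ** T"
  by (induction p)
     (simp_all add: matrix_poly_0 matrix_poly_pCons matrix_ring_simps mat_mult_commute)

lemma matrix_poly_linear_factor:
  fixes T :: "complex^'n^'n"
  shows "matrix_poly ([:- z, 1:] * q) T = matrix_poly q T ** (T - mat z)"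
proof -
  have "matrix_poly ([:- z, 1:] * q) T = mat (- z) ** matrix_poly q T + T ** matrix_poly q T"
    unfolding mult_pCons_left matrix_poly_add matrix_poly_smult matrix_poly_pCons
    by (simp add: matrix_poly_0)
  moreover have "mat (- z) ** matrix_poly q T = - (matrix_poly q T ** mat z)"
  proof -
    have "mat (- z) = - (mat z :: complex^'n^'n)"
      by (simp add: vec_eq_iff mat_def)
    then show ?thesis by (simp add: matrix_mult.minus_left matrix_mult.minus_right mat_mult_commute)
  qed
  ultimately show ?thesis
    by (simp add: matrix_ring_simps matrix_poly_commute)
qed

lemma matrix_poly_monom: "matrix_poly (monom a k) T = mat a ** mat_power T k"
proof (induction k)
  case 0
  show ?case by (simp add: monom_0 matrix_poly_pCons matrix_poly_0)
next
  case (Suc k)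
  have "T ** (mat a ** mat_power T k) = mat a ** (T ** mat_power T k)"
    by (simp add: matrix_mul_assoc mat_mult_commute[of a T])
  then show ?case by (simp add: monom_Suc matrix_poly_pCons Suc)
qed

lemma matrix_poly_sum: "matrix_poly (\<Sum>i\<in>I. f i) T = (\<Sum>i\<in>I. matrix_poly (f i) T)"
  by (induction I rule: infinite_finite_induct) (simp_all add: matrix_poly_0 matrix_poly_add)

text \<open>
  The space of matrices is finite-dimensional, so the powers of a matrix satisfy a nontrivial
  linear relation over the reals.
\<close>

lemma annihilating_polynomial:
  fixes T :: "complex^'n^'n"
  shows "\<exists>p. p \<noteq> 0 \<and> matrix_poly p T = 0"
proof -
  define N where "N = DIM(complex^'n^'n)"
  have "\<exists>c I j. finite I \<and> j \<in> I \<and> c j \<noteq> 0 \<and> (\<Sum>i\<in>I. c i *\<^sub>R mat_power T i) = 0"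
  proof (cases "inj_on (mat_power T) {..N}")
    case True
    then have "card (mat_power T ` {..N}) = Suc N"
      by (simp add: card_image)
    then have "dependent (mat_power T ` {..N})"
      by (intro dependent_biggerset) (simp add: N_def)
    then obtain u where u: "\<exists>M\<in>mat_power T ` {..N}. u M \<noteq> 0"
        "(\<Sum>M\<in>mat_power T ` {..N}. u M *\<^sub>R M) = 0"
      by (subst (asm) real_vector.dependent_finite) auto
    then have "(\<Sum>i\<le>N. u (mat_power T i) *\<^sub>R mat_power T i) = 0"
      by (simp add: sum.reindex[OF True])
    then show ?thesis
      using u(1) by (intro exI[of _ "\<lambda>i. u (mat_power T i)"] exI[of _ "{..N}"]) auto
  next
    \<comment> \<open>A repeated power is a relation in itself, but is invisible to the set of powers.\<close>
    case False
    then obtain i j where "i \<noteq> j" "mat_power T i = mat_power T j"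
      by (auto simp: inj_on_def)
    then show ?thesis
      by (intro exI[of _ "\<lambda>k. if k = i then 1 else - 1"] exI[of _ "{i, j}"] exI[of _ i]) auto
  qed
  then obtain c I j where cI: "finite I" "j \<in> I" "c j \<noteq> 0"
    "(\<Sum>i\<in>I. c i *\<^sub>R mat_power T i) = 0" by blast
  define p where "p = (\<Sum>i\<in>I. monom (complex_of_real (c i)) i)"
  have "coeff p j = (\<Sum>i\<in>I. if i = j then complex_of_real (c i) else 0)"
    by (simp add: p_def coeff_sum)
  then have "coeff p j \<noteq> 0"
    using cI by (simp add: sum.delta)
  then have "p \<noteq> 0" by auto
  moreover have "matrix_poly p T = 0"
    by (simp add: p_def matrix_poly_sum matrix_poly_monom mat_of_real matrix_mult.scaleR_left cI)
  ultimately show ?thesis by blast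
qed

lemma geometric_bound_of_recurrence:
  fixes a :: "nat \<Rightarrow> real"
  assumes rec: "\<And>k. a (Suc k) \<le> r * a k + C * \<rho> ^ k" and "0 \<le> r" "r < \<rho>"
  shows "\<exists>D. \<forall>k. a k \<le> D * \<rho> ^ k"
proof -
  define D where "D = max (a 0) (C / (\<rho> - r))"
  have C: "C \<le> (\<rho> - r) * D"
  proof -
    have "C = (\<rho> - r) * (C / (\<rho> - r))" using assms(3) by simp
    also have "\<dots> \<le> (\<rho> - r) * D"
      by (rule mult_left_mono) (use assms(3) in \<open>auto simp: D_def\<close>)
    finally show ?thesis .
  qed
  have "a k \<le> D * \<rho> ^ k" for k
  proof (induction k)
    case 0
    show ?case by (simp add: D_def)
  next
    case (Suc k)
    have "a (Suc k) \<le> r * (D * \<rho> ^ k) + ((\<rho> - r) * D) * \<rho> ^ k"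
      using rec[of k] mult_left_mono[OF Suc assms(2)] mult_right_mono[OF C, of "\<rho> ^ k"] assms
      by (smt (verit) zero_le_power)
    also have "\<dots> = D * \<rho> ^ Suc k" by (simp add: algebra_simps)
    finally show ?case .
  qed
  then show ?thesis by blast
qed

text \<open>
  The factors \<open>T - z\<close> of an annihilating polynomial are removed one at a time. If \<open>z\<close> is an
  eigenvalue, then \<open>|z| < 1\<close> and \<open>T^(k+1) W = z T^k W + T^k (T - z) W\<close> is a contraction with a
  geometrically decaying perturbation. Otherwise \<open>T - z\<close> is invertible and commutes with the powers
  of \<open>T\<close>, so it can be divided out at the price of a constant.
\<close>

lemma geometric_decay_of_annihilated:
  fixes T W :: "complex^'n^'n"
  assumes eig: "\<And>\<mu>. \<mu> \<in> eigenvalues T \<Longrightarrow> cmod \<mu> < 1"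
    and "p \<noteq> 0" "matrix_poly p T ** W = 0"
  shows "\<exists>C \<rho>. 0 < \<rho> \<and> \<rho> < 1 \<and> (\<forall>k. norm (mat_power T k ** W) \<le> C * \<rho> ^ k)"
  using assms(2,3)
proof (induction "degree p" arbitrary: p W)
  case 0
  then obtain c where c: "p = [:c:]" "c \<noteq> 0"
    by (metis degree_eq_zeroE pCons_0_0)
  then have "mat c ** W = 0"
    using 0 by (simp add: matrix_poly_pCons matrix_poly_0)
  then have "W = 0"
    using norm_mat_mult[of c W] c by simp
  then show ?case by (intro exI[of _ 0] exI[of _ "1/2"]) simp
next
  case (Suc d)
  then have "\<not> constant (poly p)" by (simp add: constant_degree)
  then obtain z where "poly p z = 0"
    using fundamental_theorem_of_algebra by blast
  then obtain q where q: "p = [:- z, 1:] * q"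
    by (auto simp: poly_eq_0_iff_dvd)
  then have "q \<noteq> 0" using Suc.prems by auto
  then have "degree p = Suc (degree q)"
    by (simp add: q degree_mult_eq del: mult_pCons_left)
  then have deg: "d = degree q" using Suc by simp
  define W' where "W' = (T - mat z) ** W"
  have "matrix_poly q T ** W' = 0"
    using Suc.prems(2) unfolding q W'_def matrix_poly_linear_factor
    by (simp add: matrix_mul_assoc)
  from Suc.hyps(1)[OF deg \<open>q \<noteq> 0\<close> this] obtain C \<rho> where \<rho>: "0 < \<rho>" "\<rho> < 1"
    and C: "\<And>k. norm (mat_power T k ** W') \<le> C * \<rho> ^ k" by blast
  have comm: "(T - mat z) ** mat_power T k = mat_power T k ** (T - mat z)" for k
    by (rule mat_power_commute) (simp add: matrix_ring_simps mat_mult_commute)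
  show ?case
  proof (cases "z \<in> eigenvalues T")
    case True
    \<comment> \<open>The rate must exceed \<open>|z|\<close> strictly: at \<open>\<rho> = |z|\<close> the recurrence only gives a bound of the
      order of \<open>k \<rho>^k\<close>.\<close>
    define \<rho>' where "\<rho>' = (max \<rho> (cmod z) + 1) / 2"
    have \<rho>': "0 < \<rho>'" "\<rho>' < 1" "\<rho> < \<rho>'" "cmod z < \<rho>'"
      using \<rho> eig[OF True] by (auto simp: \<rho>'_def)
    have "norm (mat_power T (Suc k) ** W) \<le> cmod z * norm (mat_power T k ** W) + \<bar>C\<bar> * \<rho>' ^ k"
      for k
    proof -
      have "mat_power T (Suc k) ** W = mat z ** (mat_power T k ** W) + mat_power T k ** W'"
        unfolding W'_def matrix_mul_assoc comm[of k, symmetric]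
        by (simp add: matrix_ring_simps)
      then have "norm (mat_power T (Suc k) ** W)
          \<le> cmod z * norm (mat_power T k ** W) + norm (mat_power T k ** W')"
        by (metis norm_mat_mult norm_triangle_ineq)
      also have "norm (mat_power T k ** W') \<le> \<bar>C\<bar> * \<rho>' ^ k"
        using C[of k] \<rho> \<rho>'
        by (smt (verit) mult_mono power_mono zero_le_power)
      finally show ?thesis by simp
    qed
    from geometric_bound_of_recurrence[OF this _ \<rho>'(4)] show ?thesis
      using \<rho>' by (metis norm_ge_zero)
  next
    case False
    then have inv: "invertible (T - mat z)"
      by (simp add: eigenvalue_iff_not_invertible)
    obtain K where K: "\<And>(M :: complex^'n^'n) (N :: complex^'n^'n). norm (M ** N) \<le> norm M * norm N * K" "0 \<le> K"
      using matrix_mult.nonneg_bounded by blast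
    define L where "L = norm (matrix_inv (T - mat z)) * K"
    have "norm (mat_power T k ** W) \<le> L * C * \<rho> ^ k" for k
    proof -
      have "mat_power T k ** W = matrix_inv (T - mat z) ** (mat_power T k ** W')"
        unfolding W'_def matrix_mul_assoc
        by (simp add: matrix_inv_left[OF inv] flip: comm matrix_mul_assoc)
           (simp add: matrix_inv_left[OF inv] matrix_mul_assoc)
      then have "norm (mat_power T k ** W) \<le> L * norm (mat_power T k ** W')"
        using K(1)[of "matrix_inv (T - mat z)" "mat_power T k ** W'"]
        by (simp add: L_def mult_ac)
      also have "\<dots> \<le> L * (C * \<rho> ^ k)"
        by (intro mult_left_mono C) (simp add: L_def K)
      finally show ?thesis by (simp add: mult.assoc)
    qed
    then show ?thesis using \<rho> by blast
  qed
qed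

lemma mat_power_geometric_decay:
  fixes T :: "complex^'n^'n"
  assumes "\<And>\<mu>. \<mu> \<in> eigenvalues T \<Longrightarrow> cmod \<mu> < 1"
  obtains C \<rho> where "0 < \<rho>" "\<rho> < 1" "\<And>k. norm (mat_power T k) \<le> C * \<rho> ^ k"
proof -
  obtain p where "p \<noteq> 0" "matrix_poly p T = 0"
    using annihilating_polynomial by blast
  then have "\<exists>C \<rho>. 0 < \<rho> \<and> \<rho> < 1 \<and> (\<forall>k. norm (mat_power T k ** mat 1) \<le> C * \<rho> ^ k)"
    by (intro geometric_decay_of_annihilated[OF assms]) auto
  then show ?thesis using that by auto
qed

section \<open>The doubling step\<close>

lemma invertible_uminus:
  fixes M :: "complex^'n^'n"
  assumes "invertible M"
  shows "invertible (- M)"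
proof -
  have "(- M) ** (- matrix_inv M) = mat 1"
    using assms by (simp add: matrix_ring_simps matrix_inv_right)
  then show ?thesis using invertible_right_inverse by blast
qed

lemma matrix_inv_uminus:
  fixes M :: "complex^'n^'n"
  assumes "invertible M"
  shows "matrix_inv (- M) = - matrix_inv M"
  by (rule matrix_inv_unique) (use assms in \<open>simp add: matrix_ring_simps matrix_inv_right\<close>)

lemma invertible_of_singular_values:
  fixes F :: "complex^'n^'n"
  assumes "transpose F = F" "1 \<notin> singular_values F"
  shows "invertible (mat 1 - cnj_matrix F ** F)"
proof -
  have "1 \<notin> eigenvalues (cnj_matrix F ** F)"
    using assms by (simp add: singular_values_def conj_transpose_def transpose_cnj_matrix)
  then have "invertible (cnj_matrix F ** F - mat 1)"
    by (simp add: eigenvalue_iff_not_invertible)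
  from invertible_uminus[OF this] show ?thesis by simp
qed

context
  fixes F W :: "complex^'n^'n"
  assumes inv: "invertible (mat 1 - cnj_matrix F ** F)"
  defines "W \<equiv> matrix_inv (mat 1 - cnj_matrix F ** F)"
begin

lemma cnj_step_inverse:
  "cnj_matrix W = matrix_inv (mat 1 - F ** cnj_matrix F)"
  unfolding W_def using cnj_matrix_inv[OF inv] by (simp add: cnj_matrix_simps)

text \<open>
  The push-through identity \<open>(1 - F bar F)\<^sup>-\<^sup>1 F = F (1 - bar F F)\<^sup>-\<^sup>1\<close>; it lets the inverse in a
  doubling step change sides and become conjugate.
\<close>

lemma step_inverse_push_through: "cnj_matrix W ** F = F ** W"
proof (rule matrix_mult_right_cancel[OF inv])
  have inv': "invertible (mat 1 - F ** cnj_matrix F)"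
    using invertible_cnj_matrix[OF inv] by (simp add: cnj_matrix_simps)
  have "cnj_matrix W ** F ** (mat 1 - cnj_matrix F ** F)
      = cnj_matrix W ** (mat 1 - F ** cnj_matrix F) ** F"
    by (simp add: matrix_ring_simps)
  also have "\<dots> = F"
    using matrix_inv_left[OF inv'] by (simp add: cnj_step_inverse)
  also have "\<dots> = F ** W ** (mat 1 - cnj_matrix F ** F)"
    using matrix_inv_left[OF inv] by (simp add: W_def flip: matrix_mul_assoc)
  finally show "cnj_matrix W ** F ** (mat 1 - cnj_matrix F ** F)
      = F ** W ** (mat 1 - cnj_matrix F ** F)" .
qed

lemma step_inverse_push_through_cnj: "cnj_matrix F ** cnj_matrix W = W ** cnj_matrix F"
  using arg_cong[OF step_inverse_push_through, of cnj_matrix]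
  by (simp add: cnj_matrix_simps)

text \<open>
  That \<open>E\<close> is Hermitian is carried along because the symmetry of the new \<open>F\<close> depends on it.
\<close>

lemma doubling_step_symmetric:
  assumes "transpose E = cnj_matrix E" "transpose F = F"
  shows "transpose (E ** W ** E) = cnj_matrix (E ** W ** E)"
    and "transpose (F + cnj_matrix E ** F ** W ** E) = F + cnj_matrix E ** F ** W ** E"
proof -
  have W: "transpose W = cnj_matrix W"
    unfolding cnj_step_inverse unfolding W_def
    by (simp add: transpose_matrix_inv[OF inv] transpose_diff matrix_transpose_mul
        transpose_cnj_matrix assms)
  show "transpose (E ** W ** E) = cnj_matrix (E ** W ** E)"
    by (simp add: matrix_transpose_mul cnj_matrix_mult W assms matrix_mul_assoc)
  have "transpose (cnj_matrix E ** F ** W ** E)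
      = cnj_matrix E ** (cnj_matrix W ** F) ** E"
    by (simp add: matrix_transpose_mul transpose_cnj_matrix cnj_matrix_cnj W assms
        matrix_mul_assoc)
  then show "transpose (F + cnj_matrix E ** F ** W ** E) = F + cnj_matrix E ** F ** W ** E"
    by (simp add: transpose_add assms step_inverse_push_through matrix_mul_assoc)
qed

text \<open>
  The two hypotheses are the block rows of
    \<open>[E 0; F 1] [1; X] = [1 (bar F); 0 (bar E)] [1; X] T\<close>,
  that is, the matrix pencil of the pair \<open>(E, F)\<close> acts on the graph of \<open>X\<close> as \<open>T\<close>. A doubling step
  squares the action of the pencil, whence \<open>T T\<close> in the conclusion.
\<close>

lemma doubling_step_graph:
  assumes E: "E = (mat 1 + cnj_matrix F ** X) ** T"
    and F: "F + X = cnj_matrix E ** X ** T"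
  shows "E ** W ** E = (mat 1 + cnj_matrix (F + cnj_matrix E ** F ** W ** E) ** X) ** (T ** T)"
    and "F + cnj_matrix E ** F ** W ** E + X = cnj_matrix (E ** W ** E) ** X ** (T ** T)"
proof -
  let ?W = "cnj_matrix W" and ?F = "cnj_matrix F" and ?E = "cnj_matrix E"
  have W1: "W ** (mat 1 - ?F ** F) = mat 1"
    unfolding W_def by (rule matrix_inv_left[OF inv])
  have W2: "?W ** (mat 1 - F ** ?F) = mat 1"
    using arg_cong[OF W1, of cnj_matrix] by (simp add: cnj_matrix_simps)
  have "(mat 1 + cnj_matrix (F + ?E ** F ** W ** E) ** X) ** (T ** T)
      = (mat 1 + ?F ** X) ** T ** T + E ** (?F ** ?W) ** (?E ** X ** T) ** T"
    by (simp add: cnj_matrix_simps matrix_ring_simps)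
  also have "\<dots> = E ** T + E ** W ** ?F ** (F + X) ** T"
    unfolding E[symmetric] F[symmetric] step_inverse_push_through_cnj
    by (simp add: matrix_mul_assoc)
  also have "\<dots> = E ** (W ** (mat 1 - ?F ** F)) ** T + E ** W ** ?F ** (F + X) ** T"
    by (simp add: W1)
  also have "\<dots> = E ** W ** ((mat 1 + ?F ** X) ** T)"
    by (simp add: matrix_ring_simps)
  finally show "E ** W ** E
      = (mat 1 + cnj_matrix (F + ?E ** F ** W ** E) ** X) ** (T ** T)"
    unfolding E[symmetric] ..
  have "cnj_matrix (E ** W ** E) ** X ** (T ** T) = ?E ** ?W ** (?E ** X ** T) ** T"
    by (simp add: cnj_matrix_simps matrix_mul_assoc)
  also have "\<dots> = ?E ** ?W ** ((F + X) ** T)"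
    unfolding F[symmetric] by (simp add: matrix_mul_assoc)
  also have "(F + X) ** T = (mat 1 - F ** ?F) ** X ** T + F ** ((mat 1 + ?F ** X) ** T)"
    by (simp add: matrix_ring_simps)
  also have "\<dots> = (mat 1 - F ** ?F) ** X ** T + F ** E"
    unfolding E[symmetric] ..
  also have "?E ** ?W ** \<dots>
      = ?E ** (?W ** (mat 1 - F ** ?F)) ** X ** T + ?E ** (?W ** F) ** E"
    unfolding matrix_mult.add_right matrix_mul_assoc ..
  also have "\<dots> = F + X + ?E ** F ** W ** E"
    unfolding W2 step_inverse_push_through F by (simp add: matrix_mul_assoc)
  finally show "F + ?E ** F ** W ** E + X = cnj_matrix (E ** W ** E) ** X ** (T ** T)"
    by (simp add: add_ac)
qed

end

section \<open>The initial pair\<close>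

text \<open>
  With \<open>a = A - \<alpha>\<close>, the product \<open>a (bar R)\<close> is the Schur complement \<open>Z = a - B (bar a)\<^sup>-\<^sup>1 (bar B)\<close>.
  In terms of \<open>Z\<close>, which is Hermitian when \<open>A\<close> is Hermitian and \<open>B\<close> symmetric, the symmetries of the
  initial pair become visible.
\<close>

lemma initial_pair_Schur_complement:
  fixes A B :: "complex^'n^'n" and \<alpha> :: real
  defines "a \<equiv> A - mat (of_real \<alpha>)"
  defines "Z \<equiv> a - B ** matrix_inv (cnj_matrix a) ** cnj_matrix B"
  assumes a: "invertible a" and R: "invertible (R_matrix \<alpha> A B)"
  shows "invertible Z"
    and "E_init \<alpha> A B = mat 1 + (2 * \<alpha>) *\<^sub>R matrix_inv Z"
    and "F_init \<alpha> A B
      = - ((2 * \<alpha>) *\<^sub>R (matrix_inv (cnj_matrix a) ** cnj_matrix B ** matrix_inv Z))"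
proof -
  let ?R = "cnj_matrix (R_matrix \<alpha> A B)"
  note ca = invertible_cnj_matrix[OF a]
  have ca_eq: "cnj_matrix a = cnj_matrix A - mat (of_real \<alpha>)"
    by (simp add: a_def cnj_matrix_simps)
  have "mat (of_real \<alpha>) - A = - a" "mat (of_real \<alpha>) - cnj_matrix A = - cnj_matrix a"
    unfolding ca_eq by (simp_all add: a_def)
  then have "R_matrix \<alpha> A B
      = mat 1 - matrix_inv (cnj_matrix a) ** cnj_matrix B ** matrix_inv a ** B"
    by (simp add: R_matrix_def matrix_inv_uminus a ca matrix_ring_simps)
  then have cR: "?R = mat 1 - matrix_inv a ** B ** matrix_inv (cnj_matrix a) ** cnj_matrix B"
    by (simp add: cnj_matrix_simps cnj_matrix_inv a ca)
  have Z: "Z = a ** ?R"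
    by (simp add: Z_def cR matrix_ring_simps matrix_inv_right a)
  note iR = invertible_cnj_matrix[OF R]
  show "invertible Z" unfolding Z by (intro invertible_mult a iR)
  have "a ** ?R ** (matrix_inv ?R ** matrix_inv a) = a ** (?R ** matrix_inv ?R) ** matrix_inv a"
    by (simp add: matrix_mul_assoc)
  then have Zi: "matrix_inv Z = matrix_inv ?R ** matrix_inv a"
    unfolding Z by (intro matrix_inv_unique) (simp add: matrix_inv_right a iR)
  show "E_init \<alpha> A B = mat 1 + (2 * \<alpha>) *\<^sub>R matrix_inv Z"
    by (simp add: E_init_def Zi a_def)
  show "F_init \<alpha> A B
      = - ((2 * \<alpha>) *\<^sub>R (matrix_inv (cnj_matrix a) ** cnj_matrix B ** matrix_inv Z))"
    by (simp add: F_init_def Zi ca_eq matrix_mul_assoc flip: a_def)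
qed

text \<open>
  With \<open>a\<close> and \<open>Z\<close> as above and \<open>g = G - \<alpha>\<close>, the relations are multiplied by \<open>g\<close> on the right and by
  \<open>Z\<close> or its conjugate on the left. No inverse of \<open>Z\<close> or \<open>g\<close> is left then, and both reduce to the
  shifted equations \<open>a + B X = g\<close> and \<open>bar B + (bar a) X = - X (g + 2 \<alpha>)\<close>.
\<close>

lemma initial_pair:
  fixes A B G X :: "complex^'n^'n" and \<alpha> :: real
  assumes A: "transpose A = cnj_matrix A" and B: "transpose B = B"
    and inva: "invertible (A - mat (of_real \<alpha>))" and R: "invertible (R_matrix \<alpha> A B)"
    and invg: "invertible (G - mat (of_real \<alpha>))"
    and G1: "A + B ** X = G" and G2: "cnj_matrix B + cnj_matrix A ** X = - (X ** G)"
  defines "E \<equiv> E_init \<alpha> A B" and "F \<equiv> F_init \<alpha> A B"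
    and "T \<equiv> mat 1 + (2 * \<alpha>) *\<^sub>R matrix_inv (G - mat (of_real \<alpha>))"
  shows "transpose E = cnj_matrix E" and "transpose F = F"
    and "E = (mat 1 + cnj_matrix F ** X) ** T"
    and "F + X = cnj_matrix E ** X ** T"
proof -
  define a where "a = A - mat (of_real \<alpha>)"
  define g where "g = G - mat (of_real \<alpha>)"
  define c where "c = 2 * \<alpha>"
  let ?a = "cnj_matrix a" and ?B = "cnj_matrix B"
  define Z where "Z = a - B ** matrix_inv ?a ** ?B"
  have a: "invertible a" and g: "invertible g" using inva invg by (simp_all add: a_def g_def)
  note ca = invertible_cnj_matrix[OF a]
  note init = initial_pair_Schur_complement[OF inva R, folded a_def, folded Z_def c_def]
  note Z = init(1) and cZ = invertible_cnj_matrix[OF init(1)]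
  let ?Z = "cnj_matrix Z"
  have cZ_eq: "?Z = ?a - ?B ** matrix_inv a ** B"
    by (simp add: Z_def cnj_matrix_simps cnj_matrix_inv ca)
  have E: "E = mat 1 + c *\<^sub>R matrix_inv Z"
    and F: "F = - (c *\<^sub>R (matrix_inv ?a ** ?B ** matrix_inv Z))"
    using init by (simp_all add: E_def F_def)
  have ta: "transpose a = ?a"
    by (simp add: a_def A transpose_diff cnj_matrix_simps)
  have tZ: "transpose Z = ?Z"
    by (simp add: Z_def transpose_diff matrix_transpose_mul transpose_cnj_matrix B ta
        transpose_matrix_inv ca cnj_matrix_simps cnj_matrix_inv matrix_mul_assoc)
  have tZi: "transpose (matrix_inv Z) = matrix_inv ?Z"
    by (simp add: transpose_matrix_inv Z tZ)
  show "transpose E = cnj_matrix E"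
    by (simp add: E transpose_add transpose_scalar tZi cnj_matrix_simps cnj_matrix_inv Z)
  \<comment> \<open>Push-through again: it gives \<open>F\<close> a second form, which is the transpose of the first.\<close>
  have "?B ** matrix_inv a ** Z = ?Z ** matrix_inv ?a ** ?B"
  proof -
    have "?B ** matrix_inv a ** Z
        = ?B ** (matrix_inv a ** a) - ?B ** matrix_inv a ** B ** matrix_inv ?a ** ?B"
      by (simp add: Z_def matrix_ring_simps)
    also have "\<dots> = ?a ** matrix_inv ?a ** ?B - ?B ** matrix_inv a ** B ** matrix_inv ?a ** ?B"
      by (simp add: matrix_inv_left matrix_inv_right a ca)
    also have "\<dots> = ?Z ** matrix_inv ?a ** ?B"
      by (simp add: cZ_eq matrix_ring_simps)
    finally show ?thesis .
  qed
  moreover have "matrix_inv ?Z ** (?B ** matrix_inv a ** Z) ** matrix_inv Z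
      = matrix_inv ?Z ** ?B ** matrix_inv a"
    by (simp add: matrix_inv_right Z flip: matrix_mul_assoc)
  moreover have "matrix_inv ?Z ** (?Z ** matrix_inv ?a ** ?B) ** matrix_inv Z
      = matrix_inv ?a ** ?B ** matrix_inv Z"
    by (simp add: matrix_inv_left cZ matrix_mul_assoc)
  ultimately have push: "matrix_inv ?Z ** ?B ** matrix_inv a = matrix_inv ?a ** ?B ** matrix_inv Z"
    by simp
  then have F': "F = - (c *\<^sub>R (matrix_inv ?Z ** ?B ** matrix_inv a))"
    by (simp add: F)
  have "transpose F = - (c *\<^sub>R (matrix_inv ?Z ** ?B ** matrix_inv a))"
  proof -
    have neg: "transpose (- M) = - transpose M" for M :: "complex^'n^'n"
      by (simp add: vec_eq_iff transpose_def)
    show ?thesis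
      by (simp add: F neg transpose_scalar matrix_transpose_mul tZi transpose_cnj_matrix B
          transpose_matrix_inv ca ta cnj_matrix_simps matrix_mul_assoc)
  qed
  then show "transpose F = F" by (simp add: F')
  have cF: "cnj_matrix F = - (c *\<^sub>R (matrix_inv Z ** B ** matrix_inv ?a))"
    by (simp add: F' cnj_matrix_simps cnj_matrix_inv a cZ)
  have cE: "cnj_matrix E = mat 1 + c *\<^sub>R matrix_inv ?Z"
    by (simp add: E cnj_matrix_simps cnj_matrix_inv Z)
  have g1: "g = a + B ** X"
    using G1 by (simp add: g_def a_def)
  have Gg: "G = g + \<alpha> *\<^sub>R mat 1"
    by (simp add: g_def mat_of_real)
  have "cnj_matrix A = ?a + \<alpha> *\<^sub>R mat 1"
    by (simp add: a_def cnj_matrix_simps mat_of_real)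
  then have "?B + ?a ** X + \<alpha> *\<^sub>R X = - (X ** g) - \<alpha> *\<^sub>R X"
    using G2 unfolding Gg by (simp add: matrix_ring_simps)
  moreover have "c *\<^sub>R X = \<alpha> *\<^sub>R X + \<alpha> *\<^sub>R X"
    by (simp add: c_def flip: scaleR_left_distrib)
  moreover have "X ** (g + c *\<^sub>R mat 1) = X ** g + c *\<^sub>R X"
    by (simp add: matrix_ring_simps)
  ultimately have g2: "?B + ?a ** X = - (X ** (g + c *\<^sub>R mat 1))"
    by (simp add: algebra_simps eq_diff_eq)
  have T: "T = mat 1 + c *\<^sub>R matrix_inv g"
    by (simp add: T_def g_def c_def)
  have Tg: "T ** g = g + c *\<^sub>R mat 1"
    by (simp add: T matrix_ring_simps matrix_inv_left g)
  show "E = (mat 1 + cnj_matrix F ** X) ** T"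
  proof (rule matrix_mult_right_cancel[OF g], rule matrix_mult_left_cancel[OF Z])
    have "Z ** (E ** g) = (Z + c *\<^sub>R mat 1) ** g"
      by (simp add: E matrix_ring_simps matrix_inv_right Z)
    also have "\<dots> = Z ** (g + c *\<^sub>R mat 1) + c *\<^sub>R (g - Z)"
      by (simp add: matrix_ring_simps algebra_simps)
    also have "g - Z = B ** matrix_inv ?a ** (?B + ?a ** X)"
    proof -
      have "B ** matrix_inv ?a ** (?B + ?a ** X)
          = B ** matrix_inv ?a ** ?B + B ** (matrix_inv ?a ** ?a) ** X"
        by (simp add: matrix_ring_simps)
      then show ?thesis by (simp add: matrix_inv_left ca Z_def g1)
    qed
    also have "\<dots> = - (B ** matrix_inv ?a ** X ** (g + c *\<^sub>R mat 1))"
      unfolding g2 by (simp add: matrix_mult.minus_right matrix_mul_assoc)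
    also have "Z ** (g + c *\<^sub>R mat 1) + c *\<^sub>R \<dots>
        = (Z - c *\<^sub>R (Z ** matrix_inv Z ** B ** matrix_inv ?a) ** X) ** (g + c *\<^sub>R mat 1)"
      unfolding matrix_inv_right[OF Z]
      by (simp only: matrix_mult.diff_left matrix_mult.scaleR_left matrix_mul_lid
          scaleR_minus_right add_uminus_conv_diff)
    also have "\<dots> = Z ** (mat 1 + cnj_matrix F ** X) ** (T ** g)"
      unfolding Tg cF
      by (simp only: matrix_ring_simps matrix_mul_rid add_uminus_conv_diff)
    finally show "Z ** (E ** g) = Z ** ((mat 1 + cnj_matrix F ** X) ** T ** g)"
      by (simp add: matrix_mul_assoc)
  qed
  show "F + X = cnj_matrix E ** X ** T"
  proof (rule matrix_mult_right_cancel[OF g], rule matrix_mult_left_cancel[OF cZ])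
    have Bg: "?B + ?B ** matrix_inv a ** B ** X = ?B ** matrix_inv a ** g"
    proof -
      have "?B ** matrix_inv a ** g
          = ?B ** (matrix_inv a ** a) + ?B ** matrix_inv a ** B ** X"
        by (simp add: g1 matrix_ring_simps)
      then show ?thesis by (simp add: matrix_inv_left a)
    qed
    have "?Z ** (cnj_matrix E ** X ** T ** g) = ?Z ** cnj_matrix E ** X ** (T ** g)"
      by (simp add: matrix_mul_assoc)
    also have "\<dots> = (?Z + c *\<^sub>R mat 1) ** X ** (g + c *\<^sub>R mat 1)"
      unfolding Tg cE
      by (simp only: matrix_mult.add_right matrix_mult.scaleR_right matrix_inv_right[OF cZ]
          matrix_mul_rid)
    also have "\<dots> = ?Z ** X ** g + c *\<^sub>R (?Z ** X) + c *\<^sub>R (X ** (g + c *\<^sub>R mat 1))"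
      by (simp add: matrix_ring_simps scaleR_add_right)
    also have "\<dots> = ?Z ** X ** g + c *\<^sub>R (?Z ** X) - c *\<^sub>R (?B + ?a ** X)"
      unfolding g2 by simp
    also have "\<dots> = ?Z ** X ** g - c *\<^sub>R (?B + ?B ** matrix_inv a ** B ** X)"
      by (simp add: cZ_eq matrix_ring_simps algebra_simps)
    also have "\<dots> = ?Z ** ((F + X) ** g)"
      unfolding Bg by (simp add: F' matrix_ring_simps matrix_inv_right cZ)
    finally show "?Z ** ((F + X) ** g) = ?Z ** (cnj_matrix E ** X ** T ** g)" ..
  qed
qed

section \<open>Quadratic rates\<close>

text \<open>
  Finitely many initial terms only enlarge the constant, since \<open>\<rho> ^ (2 ^ k)\<close> never vanishes.
\<close>

lemma quadratic_rate_of_eventually: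
  fixes X :: "nat \<Rightarrow> 'a::real_normed_vector"
  assumes \<rho>: "0 < \<rho>" "\<rho> < 1"
    and ev: "\<forall>\<^sub>F k in sequentially. norm (X k - L) \<le> C * \<rho> ^ (2 ^ k)"
  shows "quadratic_rate X L"
proof -
  obtain N where N: "\<And>k. k \<ge> N \<Longrightarrow> norm (X k - L) \<le> C * \<rho> ^ (2 ^ k)"
    using ev by (auto simp: eventually_sequentially)
  define q where "q = (\<lambda>k. norm (X k - L) / \<rho> ^ (2 ^ k))"
  define D where "D = \<bar>C\<bar> + 1 + (\<Sum>k<N. q k)"
  have q: "q k \<ge> 0" for k using \<rho> by (simp add: q_def)
  have "norm (X k - L) \<le> D * \<rho> ^ (2 ^ k)" for k
  proof -
    have "q k \<le> D"
    proof (cases "k < N")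
      case True
      then have "q k \<le> (\<Sum>k<N. q k)" by (intro member_le_sum) (auto simp: q)
      then show ?thesis by (simp add: D_def)
    next
      case False
      then have "q k \<le> C" using N[of k] \<rho> by (simp add: q_def field_simps)
      moreover have "(\<Sum>k<N. q k) \<ge> 0" by (intro sum_nonneg q)
      ultimately show ?thesis by (simp add: D_def)
    qed
    then show ?thesis using \<rho> by (simp add: q_def field_simps)
  qed
  moreover have "D > 0"
    using sum_nonneg[of "{..<N}" q, OF q] unfolding D_def by linarith
  ultimately show ?thesis using \<rho> unfolding quadratic_rate_def by blast
qed

lemma doubly_exponential_tendsto_0:
  fixes \<rho> :: real
  assumes "0 < \<rho>" "\<rho> < 1"
  shows "(\<lambda>k. C * \<rho> ^ (2 ^ k)) \<longlonglongrightarrow> 0"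
proof -
  have "strict_mono (\<lambda>k. 2 ^ k :: nat)"
    by (intro strict_monoI power_strict_increasing) auto
  then have "(\<lambda>k. \<rho> ^ (2 ^ k)) \<longlonglongrightarrow> 0"
    using LIMSEQ_subseq_LIMSEQ[OF LIMSEQ_power_zero[of \<rho>], of "\<lambda>k. 2 ^ k"] assms
    by (simp add: o_def)
  then show ?thesis by (rule tendsto_mult_right_zero)
qed

lemma quadratic_rate_tendsto:
  assumes "quadratic_rate X L"
  shows "X \<longlonglongrightarrow> L"
proof -
  obtain C \<rho> where *: "0 < \<rho>" "\<rho> < 1" "\<And>k. norm (X k - L) \<le> C * \<rho> ^ (2 ^ k)"
    using assms by (auto simp: quadratic_rate_def)
  have "(\<lambda>k. X k - L) \<longlonglongrightarrow> 0"
    by (rule Lim_null_comparison[OF always_eventually doubly_exponential_tendsto_0[OF *(1,2)]])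
       (use *(3) in blast)
  then show ?thesis by (simp add: LIM_zero_iff)
qed

text \<open>
  No bound on \<open>F k\<close> is known beforehand; one relation is used to remove it from the other, which
  leaves a linear equation for \<open>E k\<close> alone.
\<close>

lemma graph_relations_quadratic_rate:
  fixes E F T :: "nat \<Rightarrow> complex^'n^'n" and X :: "complex^'n^'n"
  assumes E: "\<And>k. E k = (mat 1 + cnj_matrix (F k) ** X) ** T k"
    and F: "\<And>k. F k + X = cnj_matrix (E k) ** X ** T k"
    and \<rho>: "0 < \<rho>" "\<rho> < 1" and T: "\<And>k. norm (T k) \<le> C * \<rho> ^ (2 ^ k)"
  shows "quadratic_rate E 0" and "quadratic_rate F (- X)"
proof -
  let ?X = "cnj_matrix X"
  obtain K where K: "\<And>(M :: complex^'n^'n) (N :: complex^'n^'n). norm (M ** N) \<le> norm M * norm N * K"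
      "0 \<le> K"
    using matrix_mult.nonneg_bounded by blast
  define Y where "Y k = ?X ** cnj_matrix (T k) ** X ** T k" for k
  define M where "M = mat 1 - ?X ** X"
  \<comment> \<open>Eliminating \<open>F k\<close>; the coefficient \<open>Y k\<close> tends to \<open>0\<close>, so the last term can be absorbed on the
    left without inverting \<open>1 - Y k\<close>.\<close>
  have eq: "E k = M ** T k + E k ** Y k" for k
  proof -
    have "cnj_matrix (F k) = E k ** ?X ** cnj_matrix (T k) - ?X"
      using arg_cong[OF F[of k], of cnj_matrix]
      by (simp add: cnj_matrix_simps eq_diff_eq)
    then have "E k = (mat 1 + (E k ** ?X ** cnj_matrix (T k) - ?X) ** X) ** T k"
      using E[of k] by simp
    also have "\<dots> = M ** T k + E k ** Y k"
      by (simp add: M_def Y_def matrix_ring_simps)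
    finally show ?thesis .
  qed
  have T0: "T \<longlonglongrightarrow> 0"
    by (rule Lim_null_comparison[OF always_eventually doubly_exponential_tendsto_0[OF \<rho>]])
       (use T in blast)
  have cT0: "(\<lambda>k. cnj_matrix (T k)) \<longlonglongrightarrow> 0"
    using tendsto_norm_zero[OF T0]
    by (simp add: norm_cnj_matrix flip: tendsto_norm_zero_iff[of "\<lambda>k. cnj_matrix (T k)"])
  have "(\<lambda>k. (?X ** cnj_matrix (T k) ** X) ** T k) \<longlonglongrightarrow> 0"
    by (intro matrix_mult.tendsto_zero matrix_mult.tendsto_left_zero
        matrix_mult.tendsto_right_zero cT0 T0)
  then have "Y \<longlonglongrightarrow> 0" unfolding Y_def by simp
  then have "(\<lambda>k. norm (Y k) * K) \<longlonglongrightarrow> 0"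
    by (intro tendsto_mult_left_zero tendsto_norm_zero)
  then have "\<forall>\<^sub>F k in sequentially. norm (Y k) * K < 1 / 2"
    by (rule order_tendstoD) simp
  then have "\<forall>\<^sub>F k in sequentially. norm (E k) \<le> 2 * norm M * K * C * \<rho> ^ (2 ^ k)"
  proof eventually_elim
    case (elim k)
    have "norm (E k) \<le> norm (M ** T k) + norm (E k ** Y k)"
      by (metis eq norm_triangle_ineq)
    moreover have "norm (E k ** Y k) \<le> norm (E k) * (1 / 2)"
      using K(1)[of "E k" "Y k"] mult_left_mono[OF less_imp_le[OF elim], of "norm (E k)"]
      by (simp add: mult.assoc)
    moreover have "norm (M ** T k) \<le> norm M * K * (C * \<rho> ^ (2 ^ k))"
      using K(1)[of M "T k"] mult_left_mono[OF T[of k], of "norm M * K"] K(2)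
      by (simp add: mult_ac)
    ultimately show ?case by (simp add: mult.assoc)
  qed
  then show "quadratic_rate E 0"
    by (intro quadratic_rate_of_eventually[OF \<rho>]) (simp only: diff_zero)
  then have "E \<longlonglongrightarrow> 0" by (rule quadratic_rate_tendsto)
  then have "(\<lambda>k. norm (cnj_matrix (E k) ** X)) \<longlonglongrightarrow> 0"
    by (intro tendsto_norm_zero matrix_mult.tendsto_left_zero)
       (rule tendsto_norm_zero_cancel, simp add: norm_cnj_matrix tendsto_norm_zero)
  then have "\<forall>\<^sub>F k in sequentially. norm (cnj_matrix (E k) ** X) < 1"
    by (rule order_tendstoD) simp
  then have "\<forall>\<^sub>F k in sequentially. norm (F k - - X) \<le> K * C * \<rho> ^ (2 ^ k)"
  proof eventually_elim
    case (elim k)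
    have "norm (F k - - X) = norm (cnj_matrix (E k) ** X ** T k)"
      by (simp add: F)
    also have "\<dots> \<le> norm (cnj_matrix (E k) ** X) * (norm (T k) * K)"
      using K(1)[of "cnj_matrix (E k) ** X" "T k"] by (simp add: mult_ac)
    also have "\<dots> \<le> 1 * (norm (T k) * K)"
      using elim K(2) by (intro mult_right_mono) auto
    also have "\<dots> \<le> C * \<rho> ^ (2 ^ k) * K"
      using T[of k] K(2) by (simp add: mult_right_mono)
    finally show ?case by (simp add: mult_ac)
  qed
  then show "quadratic_rate F (- X)"
    by (rule quadratic_rate_of_eventually[OF \<rho>])
qed

section \<open>The stable subspace and its Cayley transform\<close>

lemma block_matrix_mult_stack_matrix:
  fixes P Q U V M N :: "complex^'n^'n"
  shows "block_matrix P Q U V ** stack_matrix M N = stack_matrix (P ** M + Q ** N) (U ** M + V ** N)"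
proof -
  have sum: "(\<Sum>k\<in>UNIV. f k) = (\<Sum>k\<in>UNIV. f (Inl k)) + (\<Sum>k\<in>UNIV. f (Inr k))"
    for f :: "'n + 'n \<Rightarrow> complex"
    by (simp add: sum.Plus comp_def flip: UNIV_Plus_UNIV)
  show ?thesis
    by (auto simp: vec_eq_iff block_matrix_def stack_matrix_def matrix_matrix_mult_def sum
        split: sum.split)
qed

lemma stack_matrix_mult:
  fixes M N S :: "complex^'n^'n"
  shows "stack_matrix M N ** S = stack_matrix (M ** S) (N ** S)"
  by (auto simp: vec_eq_iff stack_matrix_def matrix_matrix_mult_def split: sum.split)

lemma stack_matrix_inject:
  "stack_matrix M N = stack_matrix M' N' \<longleftrightarrow> M = M' \<and> N = N'"
proof
  assume *: "stack_matrix M N = stack_matrix M' N'"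
  have "M $ i = M' $ i" "N $ i = N' $ i" for i
    using arg_cong[OF *, of "\<lambda>Q. Q $ Inl i"] arg_cong[OF *, of "\<lambda>Q. Q $ Inr i"]
    by (simp_all add: stack_matrix_def)
  then show "M = M' \<and> N = N'" by (simp add: vec_eq_iff)
qed auto

lemma eigenvalues_similar:
  fixes P S :: "complex^'n^'n"
  assumes P: "invertible P" and "\<mu> \<in> eigenvalues (P ** S ** matrix_inv P)"
  shows "\<mu> \<in> eigenvalues S"
proof -
  obtain v where v: "v \<noteq> 0" "(P ** S ** matrix_inv P) *v v = \<mu> *s v"
    using assms by (auto simp: eigenvalues_def)
  define w where "w = matrix_inv P *v v"
  have "P *v w = v"
    by (simp add: w_def matrix_vector_mul_assoc matrix_inv_right P)
  then have "w \<noteq> 0" using v(1) by auto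
  have "matrix_inv P *v ((P ** S ** matrix_inv P) *v v) = S *v w"
    by (simp add: w_def matrix_vector_mul_assoc matrix_mul_assoc matrix_inv_left P)
  then have "S *v w = \<mu> *s w"
    by (simp add: v(2) w_def vector_scalar_commute)
  with \<open>w \<noteq> 0\<close> show ?thesis by (auto simp: eigenvalues_def)
qed

text \<open>
  An eigenvalue \<open>\<mu>\<close> of the Cayley transform comes from the eigenvalue \<open>\<alpha> (\<mu> + 1) / (\<mu> - 1)\<close> of \<open>G\<close>,
  whose real part is \<open>\<alpha> (|\<mu>|\<^sup>2 - 1) / |\<mu> - 1|\<^sup>2\<close>.
\<close>

lemma Cayley_transform_eigenvalue:
  fixes G :: "complex^'n^'n"
  assumes stable: "\<And>\<mu>. \<mu> \<in> eigenvalues G \<Longrightarrow> Re \<mu> < 0" and \<alpha>: "\<alpha> > 0"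
    and g: "invertible (G - mat (of_real \<alpha>))"
    and \<mu>: "\<mu> \<in> eigenvalues (mat 1 + (2 * \<alpha>) *\<^sub>R matrix_inv (G - mat (of_real \<alpha>)))"
  shows "cmod \<mu> < 1"
proof -
  let ?g = "G - mat (complex_of_real \<alpha>)"
  obtain v where v: "v \<noteq> 0" "(mat 1 + (2 * \<alpha>) *\<^sub>R matrix_inv ?g) *v v = \<mu> *s v"
    using \<mu> by (auto simp: eigenvalues_def)
  define w where "w = matrix_inv ?g *v v"
  have gw: "?g *v w = v"
    by (simp add: w_def matrix_vector_mul_assoc matrix_inv_right g)
  then have "w \<noteq> 0" using v(1) by auto
  have Gw: "G *v w = v + of_real \<alpha> *s w"
    using gw by (simp add: matrix_vector_mult_diff_rdistrib mat_mult_vec diff_eq_eq)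
  have eq: "(2 * of_real \<alpha>) *s w = (\<mu> - 1) *s v"
  proof -
    have "(2 * \<alpha>) *\<^sub>R matrix_inv ?g = mat (of_real (2 * \<alpha>)) ** matrix_inv ?g"
      unfolding mat_of_real by (simp add: matrix_mult.scaleR_left)
    then have "v + of_real (2 * \<alpha>) *s w = \<mu> *s v"
      using v(2)
      by (simp add: matrix_vector_mult_add_rdistrib w_def flip: matrix_vector_mul_assoc mat_mult_vec)
    then show ?thesis by (simp add: algebra_simps vec_eq_iff)
  qed
  have "\<mu> \<noteq> 1"
    using eq \<open>w \<noteq> 0\<close> \<alpha> by (auto simp: vec_eq_iff)
  define z where "z = of_real \<alpha> * ((\<mu> + 1) / (\<mu> - 1))"
  have "v $ i = 2 * of_real \<alpha> / (\<mu> - 1) * w $ i" for i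
    using arg_cong[OF eq, of "\<lambda>u. u $ i"] \<open>\<mu> \<noteq> 1\<close> by (simp add: field_simps)
  moreover have "2 * of_real \<alpha> / (\<mu> - 1) + of_real \<alpha> = z"
    using \<open>\<mu> \<noteq> 1\<close> by (simp add: z_def divide_simps) (simp add: algebra_simps)
  ultimately have "G *v w = z *s w"
    unfolding Gw by (simp add: vec_eq_iff distrib_right flip: \<open>_ = z\<close>)
  then have "Re z < 0"
    using stable \<open>w \<noteq> 0\<close> by (auto simp: eigenvalues_def)
  then have "Re ((\<mu> + 1) / (\<mu> - 1)) < 0"
    unfolding z_def times_complex.sel Re_complex_of_real Im_complex_of_real
    using \<alpha> by (simp add: mult_less_0_iff del: Re_divide)
  moreover have "(Re \<mu> - 1)\<^sup>2 + (Im \<mu>)\<^sup>2 > 0"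
    using \<open>\<mu> \<noteq> 1\<close> by (simp add: complex_eq_iff sum_power2_gt_zero_iff)
  ultimately have "(Re \<mu>)\<^sup>2 + (Im \<mu>)\<^sup>2 < 1"
    by (simp add: Re_divide divide_less_0_iff algebra_simps power2_eq_square)
  then show ?thesis by (simp add: cmod_def)
qed

theorem theorem3p8:
  fixes A B X1 X2 S :: "complex^'n^'n" and \<alpha> :: real
  assumes "conj_transpose A = A"
    and "transpose B = B"
    and "\<alpha> > 0"
    and "invertible (mat (of_real \<alpha>) - H_matrix A B)"
    and "invertible (mat (of_real \<alpha>) - A)"
    and "invertible (R_matrix \<alpha> A B)"
    and "invertible (E_init \<alpha> A B)"
    and "\<And>k. 1 \<notin> singular_values (doubling_F \<alpha> A B k)"
    and "\<And>\<mu>. \<mu> \<in> eigenvalues (H_matrix A B) \<Longrightarrow> Re \<mu> \<noteq> 0"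
    and "H_matrix A B ** stack_matrix X1 X2 = stack_matrix X1 X2 ** S"
    and "invertible X1"
    and "\<And>\<mu>. \<mu> \<in> eigenvalues S \<Longrightarrow> Re \<mu> < 0"
  shows "doubling_E \<alpha> A B \<longlonglongrightarrow> 0
    \<and> doubling_F \<alpha> A B \<longlonglongrightarrow> - (X2 ** matrix_inv X1)
    \<and> quadratic_rate (doubling_E \<alpha> A B) 0
    \<and> quadratic_rate (doubling_F \<alpha> A B) (- (X2 ** matrix_inv X1))"
proof -
  define X where "X = X2 ** matrix_inv X1"
  define G where "G = X1 ** S ** matrix_inv X1"
  define T where "T = mat 1 + (2 * \<alpha>) *\<^sub>R matrix_inv (G - mat (of_real \<alpha>))"
  let ?E = "doubling_E \<alpha> A B" and ?F = "doubling_F \<alpha> A B"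
  have "stack_matrix (A ** X1 + B ** X2) (- cnj_matrix B ** X1 + - cnj_matrix A ** X2)
      = stack_matrix (X1 ** S) (X2 ** S)"
    using assms(10) by (simp only: H_matrix_def block_matrix_mult_stack_matrix stack_matrix_mult)
  then have 1: "A ** X1 + B ** X2 = X1 ** S"
    and row2: "- cnj_matrix B ** X1 + - cnj_matrix A ** X2 = X2 ** S"
    by (simp_all add: stack_matrix_inject)
  have 2: "cnj_matrix B ** X1 + cnj_matrix A ** X2 = - (X2 ** S)"
    unfolding row2[symmetric] by (simp add: matrix_mult.minus_left)
  have G1: "A + B ** X = G"
  proof -
    have "(A ** X1 + B ** X2) ** matrix_inv X1 = A ** (X1 ** matrix_inv X1) + B ** X"
      by (simp add: X_def matrix_ring_simps)
    then show ?thesis by (simp add: 1 G_def matrix_inv_right assms(11))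
  qed
  have G2: "cnj_matrix B + cnj_matrix A ** X = - (X ** G)"
  proof -
    have "(cnj_matrix B ** X1 + cnj_matrix A ** X2) ** matrix_inv X1
        = cnj_matrix B ** (X1 ** matrix_inv X1) + cnj_matrix A ** X"
      by (simp add: X_def matrix_ring_simps)
    moreover have "X ** G = X2 ** (matrix_inv X1 ** X1) ** S ** matrix_inv X1"
      by (simp add: X_def G_def matrix_mul_assoc)
    ultimately show ?thesis
      by (simp add: 2 matrix_inv_left matrix_inv_right assms(11) matrix_mult.minus_left)
  qed
  have stable: "Re \<mu> < 0" if "\<mu> \<in> eigenvalues G" for \<mu>
    using eigenvalues_similar[OF assms(11), of \<mu> S] that assms(12) by (simp add: G_def)
  \<comment> \<open>\<open>\<alpha>\<close> lies in the right half plane, hence outside the spectrum of \<open>G\<close>.\<close>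
  have g: "invertible (G - mat (of_real \<alpha>))"
    using stable[of "of_real \<alpha>"] \<open>\<alpha> > 0\<close> by (auto simp: eigenvalue_iff_not_invertible)
  have a: "invertible (A - mat (of_real \<alpha>))"
    using invertible_uminus[OF assms(5)] by simp
  have A: "transpose A = cnj_matrix A"
    using arg_cong[OF assms(1), of cnj_matrix]
    by (simp add: conj_transpose_def transpose_cnj_matrix cnj_matrix_cnj)
  note init = initial_pair[OF A assms(2) a assms(6) g G1 G2, folded T_def]
  have inv: "transpose (?E k) = cnj_matrix (?E k) \<and> transpose (?F k) = ?F k
      \<and> ?E k = (mat 1 + cnj_matrix (?F k) ** X) ** mat_power T (2 ^ k)
      \<and> ?F k + X = cnj_matrix (?E k) ** X ** mat_power T (2 ^ k)" for k
  proof (induction k)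
    case 0
    show ?case using init by simp
  next
    case (Suc k)
    then have P: "invertible (mat 1 - cnj_matrix (?F k) ** ?F k)"
      using invertible_of_singular_values assms(8) by blast
    have T: "mat_power T (2 ^ Suc k) = mat_power T (2 ^ k) ** mat_power T (2 ^ k)"
      by (simp add: mult_2 mat_power_add)
    show ?case
      unfolding T doubling_E.simps doubling_F.simps
      using doubling_step_symmetric[OF P] doubling_step_graph[OF P] Suc by blast
  qed
  have "cmod \<mu> < 1" if "\<mu> \<in> eigenvalues T" for \<mu>
    by (rule Cayley_transform_eigenvalue[OF stable \<open>\<alpha> > 0\<close> g that[unfolded T_def]])
  then obtain C \<rho> where \<rho>: "0 < \<rho>" "\<rho> < 1" and C: "\<And>k. norm (mat_power T k) \<le> C * \<rho> ^ k"
    by (rule mat_power_geometric_decay) blast+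
  have E: "?E k = (mat 1 + cnj_matrix (?F k) ** X) ** mat_power T (2 ^ k)"
    and F: "?F k + X = cnj_matrix (?E k) ** X ** mat_power T (2 ^ k)" for k
    using inv[of k] by blast+
  have "quadratic_rate ?E 0" "quadratic_rate ?F (- X)"
    by (rule graph_relations_quadratic_rate[where T = "\<lambda>k. mat_power T (2 ^ k)", OF E F \<rho> C])+
  then show ?thesis
    unfolding X_def using quadratic_rate_tendsto by blast
qed

end
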